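(* Let $m\in\mathbb{N}^*$, $p\in(0,1)$ and let $i\ge2$ be an integer. In the PA-APA random graph process with parameters $m$ and $p$, $$\mathbb{E}[d(v_i,t)]=O\left(t^{(1-p)/2}\ln (t^p)\right)\qquad\text{as } t\to\infty .$$
   Context: $\mathbb{N}^*=\{1,2,\dots\}$. The PA-APA random graph process with parameters $m\in\mathbb{N}^*$ and $p\in[0,1]$ is the following sequence $(G_t)_{t\ge1}$ of random undirected multigraphs, where $G_t$ has vertices $v_1,\dots,v_t$ and $mt$ edges. Let $d(v_i,t)$ denote the degree of $v_i$ in $G_t$ for $t\ge i$ (multiple edges are counted with multiplicity, and a self-loop contributes $2$), and $d(v_i,t)=0$ for $t<i$. Let $\mathcal{F}_t=\sigma(G_s: 1\le s\le t)$. $G_1$ consists of the single vertex $v_1$ with $m$ self-loops (so $d(v_1,1)=2m$). Let $(Y_t)_{t\ge2}$ be i.i.d. Bernoulli random variables with $\mathbb{P}(Y_t=1)=p$, with $Y_{t+1}$ independent of $\mathcal{F}_t$ for each $t\ge 1$. For each $t\ge1$, $G_{t+1}$ is obtained from $G_t$ by adding a new vertex $v_{t+1}$ and $m$ edges joining $v_{t+1}$ to vertices $W_{t+1}^1,\dots,W_{t+1}^m\in\{v_1,\dots,v_t\}$ (repetitions allowed, giving multiple edges). Given $\mathcal{F}_t$ and $Y_{t+1}$, these $m$ vertices are chosen independently, each according to: if $Y_{t+1}=0$ (preferential attachment), $v_i$ is chosen with probability $\frac{d(v_i,t)}{2mt}$, $1\le i\le t$; if $Y_{t+1}=1$ (anti-preferential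 attachment), $v_i$ is chosen with probability $\frac{2mt+1-d(v_i,t)}{t(2mt+1-2m)}$, $1\le i\le t$. *)

theory Defs
  imports
    "HOL-Probability.Probability"
    "HOL-Library.Uprod"
    "HOL-Library.Landau_Symbols"
begin

text \<open>Undirected multigraphs. An edge is an unordered pair of vertices, and
  \<open>Upair v v\<close> is a self-loop at \<open>v\<close>. The vertex \<open>v\<^sub>i\<close> of the
  process is represented by the natural number \<open>i\<close>.\<close>

datatype multigraph =
  Multigraph (verts: "nat set") (edges: "nat uprod multiset")

text \<open>The second summand counts every self-loop a second time.\<close>

definition degree :: "multigraph \<Rightarrow> nat \<Rightarrow> nat" where
  "degree H v = size {#e \<in># edges H. v \<in> set_uprod e#} + size {#e \<in># edges H. e = Upair v v#}"

definition vdeg :: "(nat \<Rightarrow> 'w \<Rightarrow> multigraph) \<Rightarrow> nat \<Rightarrow> nat \<Rightarrow> 'w \<Rightarrow> nat" where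
  "vdeg G i t \<omega> = (if t < i then 0 else degree (G t \<omega>) i)"

text \<open>The filtration \<open>\<F>\<^sub>t = \<sigma>(G\<^sub>s : 1 \<le> s \<le> t)\<close>, and
  \<open>\<sigma>(\<F>\<^sub>t, Y\<^sub>t\<^sub>+\<^sub>1)\<close>.\<close>

definition hist :: "'w measure \<Rightarrow> (nat \<Rightarrow> 'w \<Rightarrow> multigraph) \<Rightarrow> nat \<Rightarrow> 'w measure" where
  "hist M G t = sigma (space M) {G s -` A \<inter> space M | s A. s \<in> {1..t}}"

definition hist_coin ::
  "'w measure \<Rightarrow> (nat \<Rightarrow> 'w \<Rightarrow> multigraph) \<Rightarrow> (nat \<Rightarrow> 'w \<Rightarrow> bool) \<Rightarrow> nat \<Rightarrow> 'w measure" where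
  "hist_coin M G Y t =
     sigma (space M) (sets (hist M G t) \<union> {Y (Suc t) -` B \<inter> space M | B. True})"

text \<open>Probability that a given vertex of degree \<open>k\<close> in \<open>G\<^sub>t\<close> is chosen,
  under anti-preferential (\<open>y\<close> true) or preferential (\<open>y\<close> false) attachment.\<close>

definition attach_prob :: "nat \<Rightarrow> nat \<Rightarrow> bool \<Rightarrow> nat \<Rightarrow> real" where
  "attach_prob m t y k =
     (if y then (2 * real m * real t + 1 - real k) / (real t * (2 * real m * real t + 1 - 2 * real m))
      else real k / (2 * real m * real t))"

text \<open>\<open>Y\<close> is boolean-valued, with \<open>True\<close> for \<open>1\<close>. Only the indices \<open>t \<ge> 1\<close> of \<open>G\<close>,
  \<open>t \<ge> 2\<close> of \<open>Y\<close>, and \<open>t \<ge> 2\<close>, \<open>j \<in> {1..m}\<close> of \<open>W t j\<close> are meaningful.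
  The assumption \<open>choice\<close> gives the conditional joint law of the \<open>m\<close> endpoints: its product
  form says that they are conditionally independent with the prescribed distribution.\<close>

locale pa_apa = prob_space M for M :: "'w measure" +
  fixes m :: nat and p :: real
    and G :: "nat \<Rightarrow> 'w \<Rightarrow> multigraph"
    and Y :: "nat \<Rightarrow> 'w \<Rightarrow> bool"
    and W :: "nat \<Rightarrow> nat \<Rightarrow> 'w \<Rightarrow> nat"
  assumes m_pos: "1 \<le> m"
    and p_range: "0 \<le> p" "p \<le> 1"
    and G_measurable: "\<And>t. 1 \<le> t \<Longrightarrow> G t \<in> measurable M (count_space UNIV)"
    and W_measurable: "\<And>t j. 1 \<le> t \<Longrightarrow> j \<in> {1..m} \<Longrightarrow>
          W (Suc t) j \<in> measurable M (count_space UNIV)"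
    and Y_indep: "indep_vars (\<lambda>_. count_space UNIV) Y {2..}"
    and Y_distr: "\<And>t. 2 \<le> t \<Longrightarrow>
          distr M (count_space UNIV) (Y t) = measure_pmf (bernoulli_pmf p)"
    and Y_indep_hist: "\<And>t. 1 \<le> t \<Longrightarrow>
          indep_set (sets (hist M G t)) {Y (Suc t) -` B \<inter> space M | B. True}"
    and G_init: "\<And>\<omega>. \<omega> \<in> space M \<Longrightarrow>
          G 1 \<omega> = Multigraph {1} (replicate_mset m (Upair 1 1))"
    and W_range: "\<And>t j \<omega>. 1 \<le> t \<Longrightarrow> j \<in> {1..m} \<Longrightarrow> \<omega> \<in> space M \<Longrightarrow>
          W (Suc t) j \<omega> \<in> {1..t}"
    and G_step: "\<And>t \<omega>. 1 \<le> t \<Longrightarrow> \<omega> \<in> space M \<Longrightarrow>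
          G (Suc t) \<omega> = Multigraph (insert (Suc t) (verts (G t \<omega>)))
            (edges (G t \<omega>) + image_mset (\<lambda>j. Upair (Suc t) (W (Suc t) j \<omega>)) (mset_set {1..m}))"
    and choice: "\<And>t w. 1 \<le> t \<Longrightarrow> (\<And>j. j \<in> {1..m} \<Longrightarrow> w j \<in> {1..t}) \<Longrightarrow>
          AE \<omega> in M. real_cond_exp M (hist_coin M G Y t)
              (indicator {\<omega> \<in> space M. \<forall>j\<in>{1..m}. W (Suc t) j \<omega> = w j}) \<omega>
            = (\<Prod>j=1..m. attach_prob m t (Y (Suc t) \<omega>) (vdeg G (w j) t \<omega>))"

end

theory Submission
  imports Defs
begin

text \<open>Let \<open>E t\<close> be the expected degree of \<open>v\<^sub>i\<close> in \<open>G\<^sub>t\<close>. Since the degrees in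
  \<open>G\<^sub>t\<close> add up to \<open>2mt\<close>, both attachment rules are probability distributions on the vertices,
  so each of the \<open>m\<close> new edges hits \<open>v\<^sub>i\<close> with the expected value of \<open>attach_prob\<close>
  (lemma \<open>integral_choice\<close>). The coin \<open>Y\<^sub>t\<^sub>+\<^sub>1\<close> is independent of the degree, which
  turns this into an affine recursion for \<open>E\<close> (lemma \<open>expected_degree_Suc\<close>). Dropping the negative
  contribution of \<open>E t\<close> in the anti-preferential case leaves
  \<open>E (t + 1) \<le> (1 + \<alpha> / t) E t + c / t\<close> with \<open>\<alpha> = (1 - p) / 2 > 0\<close> and \<open>c = 3mp\<close>.

  The shifted sequence \<open>E t + c / \<alpha>\<close> then grows at each step by a factor of at most
  \<open>1 + \<alpha> / t \<le> (t / (t - 1))\<^sup>\<alpha>\<close>, and these factors telescope, so \<open>E t = O(t\<^sup>\<alpha>)\<close>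
  (lemma \<open>recursion_bound\<close>). This is stronger than the claimed bound, whose logarithmic factor
  \<open>ln (t\<^sup>p) = p ln t\<close> is at least \<open>p\<close> for \<open>t \<ge> 3\<close>.\<close>

section \<open>Degrees in finite multigraphs\<close>

lemma sum_degree_eq_twice_edges:
  assumes "finite V" and "\<And>e. e \<in># edges H \<Longrightarrow> set_uprod e \<subseteq> V"
  shows "(\<Sum>v\<in>V. degree H v) = 2 * size (edges H)"
proof -
  have "(\<Sum>v\<in>V. size {#e \<in># E. v \<in> set_uprod e#} + size {#e \<in># E. e = Upair v v#}) = 2 * size E"
    if "\<And>e. e \<in># E \<Longrightarrow> set_uprod e \<subseteq> V" for E :: "nat uprod multiset"
    using that
  proof (induction E)
    case empty
    then show ?case by simp
  next
    case (add e E)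
    obtain a b where e: "e = Upair a b" by (cases e)
    have ab: "a \<in> V" "b \<in> V" using add.prems[of e] by (auto simp: e)
    have "(\<Sum>v\<in>V. of_bool (v \<in> set_uprod e) + of_bool (e = Upair v v)) = (2 :: nat)"
    proof -
      have "(\<Sum>v\<in>V. of_bool (v \<in> set_uprod e) + of_bool (e = Upair v v))
          = (\<Sum>v\<in>V. of_bool (v = a) + of_bool (v = b) :: nat)"
        by (rule sum.cong) (auto simp: e)
      also have "\<dots> = 2"
        using ab assms(1) by (simp add: sum.distrib of_bool_def sum.delta)
      finally show ?thesis .
    qed
    moreover have "(\<Sum>v\<in>V. size {#e' \<in># add_mset e E. v \<in> set_uprod e'#}
            + size {#e' \<in># add_mset e E. e' = Upair v v#})
        = (\<Sum>v\<in>V. (of_bool (v \<in> set_uprod e) + of_bool (e = Upair v v))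
            + (size {#e' \<in># E. v \<in> set_uprod e'#} + size {#e' \<in># E. e' = Upair v v#}))"
      by (rule sum.cong) auto
    ultimately show ?case
      using add by (simp add: sum.distrib)
  qed
  then show ?thesis using assms(2) by (simp add: degree_def)
qed

lemma degree_le_twice_edges: "degree H v \<le> 2 * size (edges H)"
  unfolding degree_def
  using size_filter_mset_lesseq[of "\<lambda>e. v \<in> set_uprod e" "edges H"]
    size_filter_mset_lesseq[of "\<lambda>e. e = Upair v v" "edges H"] by linarith

text \<open>Only the sum of the degrees enters, so the handshake identity makes both attachment rules
  probability distributions.\<close>

lemma sum_attach_prob:
  assumes "0 < m" "0 < t" and deg: "(\<Sum>v=1..t. d v) = 2 * m * t"
  shows "(\<Sum>v=1..t. attach_prob m t y (d v)) = 1"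
proof -
  have d: "(\<Sum>v=Suc 0..t. real (d v)) = 2 * real m * real t"
    using arg_cong[OF deg, of real] by simp
  show ?thesis
  proof (cases y)
    case True
    have "real m * 1 \<le> real m * real t" using assms by (intro mult_left_mono) auto
    then have pos: "0 < 2 * real m * real t + 1 - 2 * real m" by simp
    have "(\<Sum>v=1..t. 2 * real m * real t + 1 - real (d v))
        = real t * (2 * real m * real t + 1 - 2 * real m)"
      by (simp add: sum_subtractf sum.distrib d algebra_simps)
    then show ?thesis
      using True pos assms by (simp add: attach_prob_def flip: sum_divide_distrib)
  next
    case False
    then show ?thesis
      using d assms by (simp add: attach_prob_def flip: sum_divide_distrib)
  qed
qed

section \<open>The expected degree after one step\<close>

context pa_apa
begin

lemma Y_measurable:
  assumes "1 \<le> t"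
  shows "Y (Suc t) \<in> measurable M (count_space UNIV)"
  using Y_indep assms unfolding indep_vars_def by auto

lemma vdeg_measurable:
  assumes "1 \<le> t"
  shows "vdeg G v t \<in> measurable M (count_space UNIV)"
proof (cases "t < v")
  case True
  then show ?thesis by (simp add: vdeg_def[abs_def])
next
  case False
  then have "vdeg G v t = (\<lambda>H. degree H v) \<circ> G t" by (auto simp: vdeg_def fun_eq_iff)
  then show ?thesis
    using measurable_comp[OF G_measurable[OF assms], of "\<lambda>H. degree H v" "count_space UNIV"] by simp
qed

lemma edges_G:
  assumes "1 \<le> t" "\<omega> \<in> space M"
  shows "size (edges (G t \<omega>)) = m * t \<and> (\<forall>e \<in># edges (G t \<omega>). set_uprod e \<subseteq> {1..t})"
  using assms(1)
proof (induction t rule: dec_induct)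
  case base
  then show ?case using G_init[OF assms(2)] by auto
next
  case (step t)
  have "W (Suc t) j \<omega> \<le> t \<and> 1 \<le> W (Suc t) j \<omega>" if "j \<in> {1..m}" for j
    using W_range[OF _ that assms(2), of t] step.hyps by auto
  with step show ?case
    by (fastforce simp: G_step[OF _ assms(2)])
qed

lemma vdeg_le:
  assumes "1 \<le> t" "\<omega> \<in> space M"
  shows "vdeg G v t \<omega> \<le> 2 * m * t"
  using degree_le_twice_edges[of "G t \<omega>" v] edges_G[OF assms] by (simp add: vdeg_def)

lemma integrable_vdeg:
  assumes "1 \<le> t"
  shows "integrable M (\<lambda>\<omega>. real (vdeg G v t \<omega>))"
proof (rule integrable_const_bound)
  show "AE \<omega> in M. norm (real (vdeg G v t \<omega>)) \<le> real (2 * m * t)"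
    using vdeg_le[OF assms] by (intro AE_I2) (simp del: of_nat_mult)
  show "(\<lambda>\<omega>. real (vdeg G v t \<omega>)) \<in> borel_measurable M"
    using vdeg_measurable[OF assms] by measurable
qed

lemma sum_vdeg:
  assumes "1 \<le> t" "\<omega> \<in> space M"
  shows "(\<Sum>v=1..t. vdeg G v t \<omega>) = 2 * m * t"
  using sum_degree_eq_twice_edges[of "{1..t}" "G t \<omega>"] edges_G[OF assms] by (simp add: vdeg_def)

text \<open>The endpoints of the new edges are older than the new vertex, so the new edges
  contain no self-loops and each contributes at most one to the degree of an old vertex.\<close>

lemma vdeg_Suc:
  assumes "v \<in> {1..t}" "\<omega> \<in> space M"
  shows "vdeg G v (Suc t) \<omega> = vdeg G v t \<omega> + (\<Sum>j=1..m. of_bool (W (Suc t) j \<omega> = v))"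
proof -
  define N where "N = image_mset (\<lambda>j. Upair (Suc t) (W (Suc t) j \<omega>)) (mset_set {1..m})"
  have t: "1 \<le> t" using assms by auto
  have "{#e \<in># N. e = Upair v v#} = {#}"
    using assms by (auto simp: N_def filter_mset_eq_conv)
  moreover have "size {#e \<in># N. v \<in> set_uprod e#} = card {j \<in> {1..m}. W (Suc t) j \<omega> = v}"
  proof -
    have "{j \<in> {1..m}. v \<in> set_uprod (Upair (Suc t) (W (Suc t) j \<omega>))}
        = {j \<in> {1..m}. W (Suc t) j \<omega> = v}"
      using assms by auto
    then show ?thesis by (simp add: N_def filter_mset_image_mset)
  qed
  moreover have "edges (G (Suc t) \<omega>) = edges (G t \<omega>) + N"
    by (simp add: G_step[OF t assms(2)] N_def)
  ultimately show ?thesis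
    using assms by (simp add: vdeg_def degree_def Int_def conj_assoc)
qed

lemma subalgebra_hist:
  assumes "1 \<le> t"
  shows "subalgebra M (hist M G t)"
proof -
  have "{G s -` A \<inter> space M | s A. s \<in> {1..t}} \<subseteq> sets M"
    using G_measurable by (auto intro: measurable_sets)
  then show ?thesis
    unfolding subalgebra_def hist_def
    by (auto simp: sets.sigma_sets_subset sets.sets_into_space dest: sets.sets_into_space
      simp: space_measure_of_conv sets_measure_of_conv)
qed

lemma subalgebra_hist_coin:
  assumes "1 \<le> t"
  shows "subalgebra M (hist_coin M G Y t)"
proof -
  have "sets (hist M G t) \<union> {Y (Suc t) -` B \<inter> space M | B. True} \<subseteq> sets M"
    using Y_measurable[OF assms] subalgebra_hist[OF assms]
    by (auto intro: measurable_sets simp: subalgebra_def)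
  then show ?thesis
    unfolding subalgebra_def hist_coin_def
    by (auto simp: sets.sigma_sets_subset sets.sets_into_space dest: sets.sets_into_space
      simp: space_measure_of_conv sets_measure_of_conv)
qed

lemma attach_prob_measurable:
  assumes "1 \<le> t"
  shows "(\<lambda>\<omega>. attach_prob m t (Y (Suc t) \<omega>) (vdeg G v t \<omega>)) \<in> borel_measurable M"
proof -
  note [measurable] = vdeg_measurable[OF assms] Y_measurable[OF assms]
  show ?thesis unfolding attach_prob_def by measurable
qed

text \<open>The conditional joint law of the \<open>m\<close> endpoints, integrated over the whole space.\<close>

lemma integral_choose_tuple:
  assumes "1 \<le> t" and w: "\<And>j. j \<in> {1..m} \<Longrightarrow> w j \<in> {1..t}"
  defines "P \<equiv> \<lambda>\<omega>. \<Prod>j=1..m. attach_prob m t (Y (Suc t) \<omega>) (vdeg G (w j) t \<omega>)"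
  shows "integrable M P"
    and "(\<integral>\<omega>. P \<omega> \<partial>M) = (\<integral>\<omega>. (\<Prod>j=1..m. of_bool (W (Suc t) j \<omega> = w j)) \<partial>M)"
proof -
  interpret F: finite_measure_subalgebra M "hist_coin M G Y t"
    by unfold_locales (rule subalgebra_hist_coin[OF assms(1)])
  let ?A = "{\<omega> \<in> space M. \<forall>j\<in>{1..m}. W (Suc t) j \<omega> = w j}"
  have [measurable]: "W (Suc t) j \<in> measurable M (count_space UNIV)" if "j \<in> {1..m}" for j
    using W_measurable[OF assms(1) that] .
  have A: "?A \<in> sets M"
    by measurable
  then have I: "integrable M (indicator ?A :: _ \<Rightarrow> real)"
    by (simp add: emeasure_eq_measure)
  have ae: "AE \<omega> in M. real_cond_exp M (hist_coin M G Y t) (indicator ?A) \<omega> = P \<omega>"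
    unfolding P_def by (rule choice[OF assms(1) w])
  have P: "P \<in> borel_measurable M"
    unfolding P_def by (intro borel_measurable_prod attach_prob_measurable assms)
  have cm: "real_cond_exp M (hist_coin M G Y t) (indicator ?A) \<in> borel_measurable M"
    using F.real_cond_exp_int(1)[OF I] by simp
  show "integrable M P"
    using F.real_cond_exp_int(1)[OF I] integrable_cong_AE[OF cm P ae] by simp
  have "(\<integral>\<omega>. P \<omega> \<partial>M) = (\<integral>\<omega>. indicator ?A \<omega> \<partial>M)"
    using F.real_cond_exp_int(2)[OF I] integral_cong_AE[OF cm P ae] by simp
  also have "\<dots> = (\<integral>\<omega>. (\<Prod>j=1..m. of_bool (W (Suc t) j \<omega> = w j)) \<partial>M)"
    by (intro Bochner_Integration.integral_cong refl) (auto simp: indicator_def prod_zero_iff)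
  finally show "(\<integral>\<omega>. P \<omega> \<partial>M) = (\<integral>\<omega>. (\<Prod>j=1..m. of_bool (W (Suc t) j \<omega> = w j)) \<partial>M)" .
qed

text \<open>The marginal law of one endpoint: sum the joint law over all tuples whose \<open>j\<close>-th entry
  is \<open>v\<close>. Both the indicators and the attachment probabilities sum to one over the old vertices,
  so all factors but the \<open>j\<close>-th disappear.\<close>

lemma integral_choice:
  assumes "j \<in> {1..m}" and v: "v \<in> {1..t}"
  shows "(\<integral>\<omega>. of_bool (W (Suc t) j \<omega> = v) \<partial>M)
    = (\<integral>\<omega>. attach_prob m t (Y (Suc t) \<omega>) (vdeg G v t \<omega>) \<partial>M)"
proof -
  have t: "1 \<le> t" using v by auto
  define B where "B = (\<lambda>k. if k = j then {v} else {1..t})"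
  \<comment> \<open>\<open>PiE {1..m} B\<close> is the set of tuples in \<open>{1..t}\<close> whose \<open>j\<close>-th entry is \<open>v\<close>.\<close>
  have B: "g k \<in> {1..t}" if "g \<in> PiE {1..m} B" "k \<in> {1..m}" for g k
    using PiE_mem[OF that] v by (auto simp: B_def split: if_splits)
  have single: "(\<Prod>k=1..m. \<Sum>u\<in>B k. f k u) = f j v"
    if "\<And>k. k \<in> {1..m} \<Longrightarrow> (\<Sum>u=1..t. f k u) = 1" for f :: "nat \<Rightarrow> nat \<Rightarrow> real"
  proof -
    have "(\<Prod>k=1..m. \<Sum>u\<in>B k. f k u) = (\<Prod>k=1..m. if k = j then f k v else 1)"
      using that by (intro prod.cong) (auto simp: B_def)
    also have "\<dots> = f j v" using assms(1) by (simp add: prod.delta)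
    finally show ?thesis .
  qed
  have W1: "(\<Prod>k=1..m. \<Sum>u\<in>B k. of_bool (W (Suc t) k \<omega> = u)) = (of_bool (W (Suc t) j \<omega> = v) :: real)"
    if "\<omega> \<in> space M" for \<omega>
  proof (rule single)
    fix k assume "k \<in> {1..m}"
    then show "(\<Sum>u=1..t. of_bool (W (Suc t) k \<omega> = u)) = (1 :: real)"
      using W_range[OF t _ that, of k] by (simp add: of_bool_def sum.delta)
  qed
  have A1: "(\<Prod>k=1..m. \<Sum>u\<in>B k. attach_prob m t (Y (Suc t) \<omega>) (vdeg G u t \<omega>))
      = attach_prob m t (Y (Suc t) \<omega>) (vdeg G v t \<omega>)" if "\<omega> \<in> space M" for \<omega>
    by (rule single) (use m_pos t sum_vdeg[OF t that] in \<open>intro sum_attach_prob; simp\<close>)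
  have expand: "(\<Prod>k=1..m. \<Sum>u\<in>B k. f k u) = (\<Sum>g\<in>PiE {1..m} B. \<Prod>k=1..m. f k (g k))"
    for f :: "nat \<Rightarrow> nat \<Rightarrow> real"
    by (rule prod_sum_PiE) (auto simp: B_def)
  have Wint: "integrable M (\<lambda>\<omega>. \<Prod>k=1..m. of_bool (W (Suc t) k \<omega> = g k) :: real)" for g
  proof (rule integrable_const_bound[where B = 1])
    have [measurable]: "W (Suc t) k \<in> measurable M (count_space UNIV)" if "k \<in> {1..m}" for k
      using W_measurable[OF t that] .
    show "(\<lambda>\<omega>. \<Prod>k=1..m. of_bool (W (Suc t) k \<omega> = g k) :: real) \<in> borel_measurable M"
      by measurable
    show "AE \<omega> in M. norm (\<Prod>k=1..m. of_bool (W (Suc t) k \<omega> = g k) :: real) \<le> 1"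
      by (intro AE_I2) (auto simp: abs_prod intro!: prod_le_1)
  qed
  have "(\<integral>\<omega>. of_bool (W (Suc t) j \<omega> = v) \<partial>M)
      = (\<integral>\<omega>. (\<Sum>g\<in>PiE {1..m} B. \<Prod>k=1..m. of_bool (W (Suc t) k \<omega> = g k) :: real) \<partial>M)"
    by (intro Bochner_Integration.integral_cong refl) (simp only: W1[unfolded expand])
  also have "\<dots> = (\<Sum>g\<in>PiE {1..m} B. \<integral>\<omega>. (\<Prod>k=1..m. of_bool (W (Suc t) k \<omega> = g k) :: real) \<partial>M)"
    by (intro Bochner_Integration.integral_sum Wint)
  also have "\<dots> = (\<Sum>g\<in>PiE {1..m} B.
      \<integral>\<omega>. (\<Prod>k=1..m. attach_prob m t (Y (Suc t) \<omega>) (vdeg G (g k) t \<omega>)) \<partial>M)"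
    by (intro sum.cong refl integral_choose_tuple(2)[OF t, symmetric] B)
  also have "\<dots> = (\<integral>\<omega>. (\<Sum>g\<in>PiE {1..m} B.
      \<Prod>k=1..m. attach_prob m t (Y (Suc t) \<omega>) (vdeg G (g k) t \<omega>)) \<partial>M)"
    by (intro Bochner_Integration.integral_sum[symmetric] integral_choose_tuple(1)[OF t] B)
  also have "\<dots> = (\<integral>\<omega>. attach_prob m t (Y (Suc t) \<omega>) (vdeg G v t \<omega>) \<partial>M)"
    by (intro Bochner_Integration.integral_cong refl) (simp only: A1[unfolded expand])
  finally show ?thesis .
qed

lemma integral_Y:
  assumes "1 \<le> t"
  shows "(\<integral>\<omega>. of_bool (Y (Suc t) \<omega>) \<partial>M) = p"
proof -
  have "(\<integral>\<omega>. of_bool (Y (Suc t) \<omega>) \<partial>M) = (\<integral>y. (of_bool y :: real) \<partial>(distr M (count_space UNIV) (Y (Suc t))))"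
    by (intro integral_distr[OF Y_measurable[OF assms], of of_bool, symmetric]) simp
  also have "\<dots> = (\<integral>y. of_bool y \<partial>measure_pmf (bernoulli_pmf p))"
    using Y_distr[of "Suc t"] assms by simp
  also have "\<dots> = p" using p_range by simp
  finally show ?thesis .
qed

text \<open>Independence of the coin from the history factorises the expectation.\<close>

lemma integral_vdeg_Y:
  assumes "v \<in> {1..t}"
  shows "integrable M (\<lambda>\<omega>. real (vdeg G v t \<omega>) * of_bool (Y (Suc t) \<omega>))"
    and "(\<integral>\<omega>. real (vdeg G v t \<omega>) * of_bool (Y (Suc t) \<omega>) \<partial>M) = (\<integral>\<omega>. real (vdeg G v t \<omega>) \<partial>M) * p"
proof -
  have t: "1 \<le> t" using assms by auto
  note [measurable] = vdeg_measurable[OF t] Y_measurable[OF t]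
  have Int_stable: "Int_stable {X -` A \<inter> space M |A. A \<in> sets N}" for X and N :: "real measure"
  proof (safe intro!: Int_stableI)
    fix A A' assume "A \<in> sets N" "A' \<in> sets N"
    then show "\<exists>C. (X -` A \<inter> space M) \<inter> (X -` A' \<inter> space M) = X -` C \<inter> space M \<and> C \<in> sets N"
      by (intro exI[of _ "A \<inter> A'"]) auto
  qed
  have "indep_var (borel :: real measure) (\<lambda>\<omega>. real (vdeg G v t \<omega>)) (borel :: real measure) (\<lambda>\<omega>. of_bool (Y (Suc t) \<omega>))"
    unfolding indep_var_eq
  proof (intro conjI indep_set_sigma_sets indep_setI)
    fix a b
    assume "a \<in> {(\<lambda>\<omega>. real (vdeg G v t \<omega>)) -` A \<inter> space M |A. A \<in> sets borel}"
      and "b \<in> {(\<lambda>\<omega>. of_bool (Y (Suc t) \<omega>)) -` A \<inter> space M |A. A \<in> sets (borel :: real measure)}"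
    then obtain A A' where a: "a = (\<lambda>\<omega>. real (vdeg G v t \<omega>)) -` A \<inter> space M"
      and b: "b = (\<lambda>\<omega>. of_bool (Y (Suc t) \<omega>)) -` (A' :: real set) \<inter> space M" by auto
    have "a = G t -` {H. real (degree H v) \<in> A} \<inter> space M"
      using assms by (auto simp: a vdeg_def)
    then have "a \<in> sets (hist M G t)"
      using t unfolding hist_def sets_measure_of_conv
      by (auto simp del: vimage_Collect_eq intro!: sigma_sets.Basic)
    moreover have "b = Y (Suc t) -` {y. of_bool y \<in> A'} \<inter> space M"
      by (auto simp: b)
    then have "b \<in> {Y (Suc t) -` B \<inter> space M | B. True}" by blast
    ultimately show "prob (a \<inter> b) = prob a * prob b"
      by (rule indep_setD[OF Y_indep_hist[OF t]])
  qed (use Y_indep_hist[OF t] in \<open>auto simp: Int_stable\<close>)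
  moreover have "integrable M (\<lambda>\<omega>. of_bool (Y (Suc t) \<omega>) :: real)"
    by (rule integrable_const_bound[where B = 1]) auto
  ultimately show "integrable M (\<lambda>\<omega>. real (vdeg G v t \<omega>) * of_bool (Y (Suc t) \<omega>))"
    and "(\<integral>\<omega>. real (vdeg G v t \<omega>) * of_bool (Y (Suc t) \<omega>) \<partial>M) = (\<integral>\<omega>. real (vdeg G v t \<omega>) \<partial>M) * p"
    using indep_var_integrable[of "\<lambda>\<omega>. real (vdeg G v t \<omega>)" "\<lambda>\<omega>. of_bool (Y (Suc t) \<omega>)"]
      indep_var_lebesgue_integral[of "\<lambda>\<omega>. real (vdeg G v t \<omega>)" "\<lambda>\<omega>. of_bool (Y (Suc t) \<omega>)"]
      integrable_vdeg[OF t, of v] integral_Y[OF t] by auto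
qed

lemma integral_attach_prob:
  fixes t v
  assumes "v \<in> {1..t}"
  defines "E \<equiv> \<integral>\<omega>. real (vdeg G v t \<omega>) \<partial>M"
  shows "(\<integral>\<omega>. attach_prob m t (Y (Suc t) \<omega>) (vdeg G v t \<omega>) \<partial>M)
    = p * (2 * real m * real t + 1 - E) / (real t * (2 * real m * real t + 1 - 2 * real m))
      + (1 - p) * E / (2 * real m * real t)"
proof -
  have t: "1 \<le> t" using assms by auto
  define a where "a = 2 * real m * real t + 1"
  define D where "D = real t * (2 * real m * real t + 1 - 2 * real m)"
  note [measurable] = Y_measurable[OF t]
  have iY: "integrable M (\<lambda>\<omega>. of_bool (Y (Suc t) \<omega>) :: real)"
    by (rule integrable_const_bound[where B = 1]) auto
  note int = iY integrable_vdeg[OF t, of v] integral_vdeg_Y(1)[OF assms(1)]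
  have "(\<integral>\<omega>. attach_prob m t (Y (Suc t) \<omega>) (vdeg G v t \<omega>) \<partial>M)
    = (\<integral>\<omega>. (a * of_bool (Y (Suc t) \<omega>) - real (vdeg G v t \<omega>) * of_bool (Y (Suc t) \<omega>)) / D
        + (real (vdeg G v t \<omega>) - real (vdeg G v t \<omega>) * of_bool (Y (Suc t) \<omega>)) / (2 * real m * real t) \<partial>M)"
    by (intro Bochner_Integration.integral_cong refl) (auto simp: attach_prob_def a_def D_def)
  also have "\<dots> = (a * p - E * p) / D + (E - E * p) / (2 * real m * real t)"
    using int by (simp add: integral_vdeg_Y(2)[OF assms(1)] integral_Y[OF t] E_def)
  finally show ?thesis by (simp add: a_def D_def algebra_simps)
qed

lemma expected_degree_Suc:
  fixes t v
  assumes "v \<in> {1..t}"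
  defines "E \<equiv> \<lambda>t. \<integral>\<omega>. real (vdeg G v t \<omega>) \<partial>M"
  shows "E (Suc t) = E t + real m *
     (p * (2 * real m * real t + 1 - E t) / (real t * (2 * real m * real t + 1 - 2 * real m))
      + (1 - p) * E t / (2 * real m * real t))"
proof -
  have t: "1 \<le> t" using assms by auto
  have iW: "integrable M (\<lambda>\<omega>. of_bool (W (Suc t) j \<omega> = v) :: real)" if "j \<in> {1..m}" for j
  proof -
    note [measurable] = W_measurable[OF t that]
    show ?thesis by (rule integrable_const_bound[where B = 1]) auto
  qed
  have "E (Suc t) = (\<integral>\<omega>. real (vdeg G v t \<omega>) + (\<Sum>j=1..m. of_bool (W (Suc t) j \<omega> = v)) \<partial>M)"
    unfolding E_def using assms(1)
    by (intro Bochner_Integration.integral_cong refl) (simp add: vdeg_Suc)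
  also have "\<dots> = E t + (\<Sum>j=1..m. \<integral>\<omega>. of_bool (W (Suc t) j \<omega> = v) \<partial>M)"
    using iW integrable_vdeg[OF t, of v]
    by (subst Bochner_Integration.integral_add)
      (auto simp: E_def simp del: sum_of_bool_eq intro!: Bochner_Integration.integral_sum
        Bochner_Integration.integrable_sum)
  also have "\<dots> = E t + real m * (\<integral>\<omega>. attach_prob m t (Y (Suc t) \<omega>) (vdeg G v t \<omega>) \<partial>M)"
    by (simp add: integral_choice[OF _ assms(1)])
  finally show ?thesis
    by (simp add: integral_attach_prob[OF assms(1)] E_def)
qed

text \<open>For \<open>t \<ge> 2\<close> the denominator satisfies \<open>3 (2mt + 1 - 2m) \<ge> 2mt + 1\<close>,
  which is where the constant 3 comes from.\<close>

lemma expected_degree_Suc_le: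
  fixes t v
  assumes "v \<in> {1..t}" "2 \<le> t"
  defines "E \<equiv> \<lambda>t. \<integral>\<omega>. real (vdeg G v t \<omega>) \<partial>M"
  shows "E (Suc t) \<le> (1 + (1 - p) / 2 / real t) * E t + 3 * real m * p / real t"
proof -
  have "0 \<le> E t" unfolding E_def by simp
  have "2 \<le> real m * real t"
    using mult_mono[of 1 "real m" 2 "real t"] m_pos assms by simp
  moreover have "2 * real m \<le> real m * real t"
    using mult_left_mono[of 2 "real t" "real m"] assms(2) by (simp add: mult.commute)
  moreover define D where "D = 2 * real m * real t + 1 - 2 * real m"
  ultimately have D: "0 < D" "2 * real m * real t + 1 \<le> 3 * D"
    by (simp_all add: algebra_simps)
  have "(2 * real m * real t + 1 - E t) / (real t * D) \<le> 3 * D / (real t * D)"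
    using D \<open>0 \<le> E t\<close> by (intro divide_right_mono) auto
  also have "\<dots> = 3 / real t" using D by simp
  finally have "real m * p * ((2 * real m * real t + 1 - E t) / (real t * D))
      \<le> real m * p * (3 / real t)"
    using p_range by (intro mult_left_mono) auto
  moreover have "real m * ((1 - p) * E t / (2 * real m * real t)) = (1 - p) / 2 / real t * E t"
    using m_pos by simp
  ultimately show ?thesis
    using expected_degree_Suc[OF assms(1)]
    unfolding E_def D_def[symmetric] by (simp add: algebra_simps)
qed

end

section \<open>Growth of the recursion\<close>

lemma one_plus_div_le_powr:
  fixes \<alpha> t :: real
  assumes "0 \<le> \<alpha>" "1 < t"
  shows "1 + \<alpha> / t \<le> (t / (t - 1)) powr \<alpha>"
proof -
  have "1 / t \<le> - ln (1 - 1 / t)"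
    using ln_le_minus_one[of "1 - 1 / t"] assms by simp
  also have "\<dots> = ln (t / (t - 1))"
    using assms by (simp add: ln_div diff_divide_distrib[symmetric] field_simps)
  finally have "\<alpha> * (1 / t) \<le> \<alpha> * ln (t / (t - 1))"
    using assms by (intro mult_left_mono)
  then have "exp (\<alpha> / t) \<le> exp (\<alpha> * ln (t / (t - 1)))" by simp
  then show ?thesis
    using assms order_trans[OF exp_ge_add_one_self[of "\<alpha> / t"]] by (simp add: powr_def)
qed

lemma recursion_bound:
  fixes a :: "nat \<Rightarrow> real" and n :: nat
  assumes "0 < \<alpha>" "0 \<le> c" "2 \<le> n" "0 \<le> a n"
    and rec: "\<And>t. n \<le> t \<Longrightarrow> a (Suc t) \<le> (1 + \<alpha> / real t) * a t + c / real t"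
    and t: "n \<le> t"
  shows "a t \<le> (a n + c / \<alpha>) * real t powr \<alpha>"
proof -
  define C where "C = a n + c / \<alpha>"
  have C: "0 \<le> C" using assms by (simp add: C_def)
  \<comment> \<open>The shift by \<open>c / \<alpha>\<close> makes the recursion homogeneous; the base \<open>t - 1\<close> rather than
    \<open>t\<close> is what the factor \<open>t / (t - 1)\<close> telescopes against.\<close>
  have "a t + c / \<alpha> \<le> C * (real t - 1) powr \<alpha>"
    using t
  proof (induction t rule: dec_induct)
    case base
    have "1 \<le> (real n - 1) powr \<alpha>" using assms by (intro ge_one_powr_ge_zero) auto
    then show ?case using C mult_left_mono[of 1 "(real n - 1) powr \<alpha>" C] by (simp add: C_def)
  next
    case (step t)
    have "a (Suc t) + c / \<alpha> \<le> (1 + \<alpha> / real t) * (a t + c / \<alpha>)"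
      using rec[OF step.hyps(1)] assms(1) by (simp add: algebra_simps)
    also have "\<dots> \<le> (1 + \<alpha> / real t) * (C * (real t - 1) powr \<alpha>)"
      using step assms by (intro mult_left_mono) auto
    also have "\<dots> \<le> (real t / (real t - 1)) powr \<alpha> * (C * (real t - 1) powr \<alpha>)"
      using one_plus_div_le_powr[of \<alpha> "real t"] step assms C by (intro mult_right_mono) auto
    also have "\<dots> = C * real t powr \<alpha>"
      using step assms by (simp add: powr_divide)
    finally show ?case by simp
  qed
  moreover have "0 \<le> c / \<alpha>" using assms by simp
  ultimately have "a t \<le> C * (real t - 1) powr \<alpha>" by linarith
  also have "\<dots> \<le> C * real t powr \<alpha>"
    using C t assms by (intro mult_left_mono powr_mono2) auto
  finally show ?thesis by (simp add: C_def)
qed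

theorem theorem3p4:
  fixes M :: "'w measure" and m i :: nat and p :: real
    and G :: "nat \<Rightarrow> 'w \<Rightarrow> multigraph"
    and Y :: "nat \<Rightarrow> 'w \<Rightarrow> bool"
    and W :: "nat \<Rightarrow> nat \<Rightarrow> 'w \<Rightarrow> nat"
  assumes "1 \<le> m" and "0 < p" and "p < 1" and "2 \<le> i"
    and "pa_apa M m p G Y W"
  shows "(\<lambda>t. \<integral>\<omega>. real (vdeg G i t \<omega>) \<partial>M)
           \<in> O[at_top](\<lambda>t. real t powr ((1 - p) / 2) * ln (real t powr p))"
proof -
  interpret pa_apa M m p G Y W by fact
  define E where "E = (\<lambda>t. \<integral>\<omega>. real (vdeg G i t \<omega>) \<partial>M)"
  define C where "C = E i + 3 * real m * p / ((1 - p) / 2)"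
  have E_nonneg: "0 \<le> E t" for t unfolding E_def by simp
  have bound: "E t \<le> C * real t powr ((1 - p) / 2)" if "i \<le> t" for t
    unfolding C_def
  proof (rule recursion_bound)
    fix s assume "i \<le> s"
    then show "E (Suc s) \<le> (1 + (1 - p) / 2 / real s) * E s + 3 * real m * p / real s"
      using expected_degree_Suc_le[of i s] assms unfolding E_def by simp
  qed (use assms E_nonneg that in auto)
  have C: "0 \<le> C" using E_nonneg assms by (simp add: C_def)
  have "eventually (\<lambda>t. norm (E t) \<le> C / p * norm (real t powr ((1 - p) / 2) * ln (real t powr p))) at_top"
    using eventually_ge_at_top[of i] eventually_ge_at_top[of 3]
  proof eventually_elim
    case (elim t)
    have "exp 1 \<le> real t" using exp_le elim by linarith
    then have ln: "1 \<le> ln (real t)" using elim by (subst ln_ge_iff) auto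
    have "E t \<le> C * real t powr ((1 - p) / 2) * 1" using bound elim by simp
    also have "\<dots> \<le> C * real t powr ((1 - p) / 2) * ln (real t)"
      using ln C by (intro mult_left_mono) auto
    finally show ?case
      using E_nonneg[of t] ln assms elim by (simp add: ln_powr abs_mult)
  qed
  then show ?thesis unfolding E_def by (rule bigoI)
qed

end
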